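(* Let $p\in(1,\infty)$. Let $\mathbb{X}=(X,\mathcal{B},\mu,T)$ be a measure-preserving dynamical system, where $(X,\mathcal{B},\mu)$ is a nontrivial $\sigma$-finite measure space and $T\colon X\to X$ is an invertible, ergodic measure-preserving transformation. Assume that for each $L\in\mathbb{N}$ there exists $E_L\in\mathcal{B}$ such that $\mu(E_L)\in(0,\infty)$ and the sets $T^{-l}(E_L)$, $l\in\{1,\dots,L\}$, are disjoint. Then $\mathcal{C}^{\rm u}(\mathbb{X},p)=c_p$, where $c_p$ is the best constant in the strong type $(p,p)$ inequality for the uncentered Hardy–Littlewood maximal operator $\mathcal{M}^{\rm u}_{\mathbb{R}}$ on $\mathbb{R}$.
   Context: $\mathbb{N}=\{1,2,\dots\}$. A measure space is nontrivial if it has a measurable subset of finite and strictly positive measure. $T$ is measure-preserving if it is measurable and $\mu(T^{-1}(E))=\mu(E)$ for all $E\in\mathcal{B}$; invertible means bijective with measurable (hence measure-preserving) inverse; $T$ is ergodic if, for $E\in\mathcal{B}$, $T^{-1}(E)=E$ implies $\mu(E)=0$ or $\mu(X\setminus E)=0$. For measurable $f\colon X\to\mathbb{R}$ the uncentered maximal operator is $$T_*^{\rm u}f(x)=\sup_{\underline r,\overline r\in\mathbb{N}\cup\{0\}}\Big|\frac1{\underline r+\overline r+1}\sum_{n=-\underline r}^{\overline r}f(T^nx)\Big|,$$ and $\mathcal{C}^{\rm u}(\mathbb{X},p)$ is the smallest constant $C$ such that $\|T_*^{\rm u}f\|_p\le C\|f\|_p$ for all $f\in L^p(\mathbb{X})$.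 $\mathcal{M}^{\rm u}_{\mathbb{R}}f(x)=\sup_{I\ni x}\frac1{|I|}\int_I|f(y)|\,dy$, the supremum being over all bounded intervals $I\subset\mathbb{R}$ of positive length containing $x$; $c_p$ is the smallest constant $C$ such that $\|\mathcal{M}^{\rm u}_{\mathbb{R}}f\|_{L^p(\mathbb{R})}\le C\|f\|_{L^p(\mathbb{R})}$ for all $f\in L^p(\mathbb{R})$ (Lebesgue measure). *)

theory Defs
  imports "HOL-Analysis.Analysis"
begin

definition measure_preserving :: "'a measure \<Rightarrow> ('a \<Rightarrow> 'a) \<Rightarrow> bool" where
  "measure_preserving M T \<longleftrightarrow>
     T \<in> measurable M M \<and> (\<forall>E\<in>sets M. emeasure M (T -` E \<inter> space M) = emeasure M E)"

definition invertible_on_space :: "'a measure \<Rightarrow> ('a \<Rightarrow> 'a) \<Rightarrow> bool" where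
  "invertible_on_space M T \<longleftrightarrow>
     bij_betw T (space M) (space M) \<and> inv_into (space M) T \<in> measurable M M"

definition ergodic :: "'a measure \<Rightarrow> ('a \<Rightarrow> 'a) \<Rightarrow> bool" where
  "ergodic M T \<longleftrightarrow>
     (\<forall>E\<in>sets M. T -` E \<inter> space M = E \<longrightarrow> emeasure M E = 0 \<or> emeasure M (space M - E) = 0)"

definition nontrivial_measure :: "'a measure \<Rightarrow> bool" where
  "nontrivial_measure M \<longleftrightarrow> (\<exists>E\<in>sets M. 0 < emeasure M E \<and> emeasure M E < \<infinity>)"

definition int_iterate :: "'a measure \<Rightarrow> ('a \<Rightarrow> 'a) \<Rightarrow> int \<Rightarrow> 'a \<Rightarrow> 'a" where
  "int_iterate M T n =
     (if 0 \<le> n then T ^^ nat n else inv_into (space M) T ^^ nat (- n))"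

(* Maximal functions may take the value \<infinity> at some points, so norms are defined for
   functions with values in the extended nonnegative reals; for p > 0 the power below
   sends \<infinity> to \<infinity>. *)

definition ennpow :: "ennreal \<Rightarrow> real \<Rightarrow> ennreal" where
  "ennpow x p = (if x = \<infinity> then \<infinity> else ennreal (enn2real x powr p))"

definition Lp_norm :: "real \<Rightarrow> 'a measure \<Rightarrow> ('a \<Rightarrow> ennreal) \<Rightarrow> ennreal" where
  "Lp_norm p M g = ennpow (\<integral>\<^sup>+x. ennpow (g x) p \<partial>M) (1 / p)"

definition Lp_space :: "real \<Rightarrow> 'a measure \<Rightarrow> ('a \<Rightarrow> real) set" where
  "Lp_space p M =
     {f \<in> borel_measurable M. Lp_norm p M (\<lambda>x. ennreal \<bar>f x\<bar>) < \<infinity>}"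

definition strong_type_bound ::
    "real \<Rightarrow> 'a measure \<Rightarrow> (('a \<Rightarrow> real) \<Rightarrow> 'a \<Rightarrow> ennreal) \<Rightarrow> ennreal \<Rightarrow> bool" where
  "strong_type_bound p M S C \<longleftrightarrow>
     (\<forall>f\<in>Lp_space p M. Lp_norm p M (S f) \<le> C * Lp_norm p M (\<lambda>x. ennreal \<bar>f x\<bar>))"

(* The infimum is \<infinity> if there is no finite admissible constant; otherwise it is itself
   admissible, hence the smallest admissible constant, see best_constant_admissible. *)

definition best_constant ::
    "real \<Rightarrow> 'a measure \<Rightarrow> (('a \<Rightarrow> real) \<Rightarrow> 'a \<Rightarrow> ennreal) \<Rightarrow> ennreal" where
  "best_constant p M S = Inf {C. strong_type_bound p M S C}"

lemma best_constant_le: "strong_type_bound p M S C \<Longrightarrow> best_constant p M S \<le> C"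
  by (simp add: best_constant_def Inf_lower)

lemma best_constant_admissible:
  assumes "best_constant p M S < \<infinity>"
  shows "strong_type_bound p M S (best_constant p M S)"
  unfolding strong_type_bound_def
proof
  fix f assume f: "f \<in> Lp_space p M"
  define N where "N = Lp_norm p M (\<lambda>x. ennreal \<bar>f x\<bar>)"
  let ?c = "best_constant p M S"
  have N: "N < \<infinity>" using f by (simp add: Lp_space_def N_def)
  have approx: "Lp_norm p M (S f) \<le> (?c + ennreal e) * N" if "e > 0" for e :: real
  proof -
    have "?c < ?c + ennreal e"
      using assms that by (cases ?c) (auto simp: ennreal_less_iff simp flip: ennreal_plus)
    then obtain C where "strong_type_bound p M S C" "C < ?c + ennreal e"
      unfolding best_constant_def by (auto simp: Inf_less_iff)
    then show ?thesis
      using f unfolding strong_type_bound_def N_def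
      by (meson less_imp_le mult_right_mono order_trans zero_le)
  qed
  have "Lp_norm p M (S f) \<le> ?c * N"
  proof (rule ennreal_le_epsilon)
    fix e :: real assume "e > 0"
    define d where "d = e / (enn2real N + 1)"
    have "d > 0" using \<open>e > 0\<close> by (simp add: d_def add_nonneg_pos)
    have "d * enn2real N \<le> e"
      using \<open>e > 0\<close> by (simp add: d_def divide_simps add_nonneg_pos)
    then have "ennreal d * N \<le> ennreal e"
      using N \<open>d > 0\<close> by (cases N) (auto simp: ennreal_leI simp flip: ennreal_mult)
    then show "Lp_norm p M (S f) \<le> ?c * N + ennreal e"
      using approx[OF \<open>d > 0\<close>] by (simp add: distrib_right) (meson add_left_mono order_trans)
  qed
  then show "Lp_norm p M (S f) \<le> ?c * Lp_norm p M (\<lambda>x. ennreal \<bar>f x\<bar>)"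
    by (simp add: N_def)
qed

definition ergodic_maximal ::
    "'a measure \<Rightarrow> ('a \<Rightarrow> 'a) \<Rightarrow> ('a \<Rightarrow> real) \<Rightarrow> 'a \<Rightarrow> ennreal" where
  "ergodic_maximal M T f x =
     (SUP (r, s) \<in> (UNIV :: (nat \<times> nat) set).
        ennreal \<bar>1 / (real r + real s + 1) * (\<Sum>n = - int r..int s. f (int_iterate M T n x))\<bar>)"

definition HL_maximal :: "(real \<Rightarrow> real) \<Rightarrow> real \<Rightarrow> ennreal" where
  "HL_maximal f x =
     (SUP I \<in> {I. is_interval I \<and> bounded I \<and> 0 < emeasure lebesgue I \<and> x \<in> I}.
        (\<integral>\<^sup>+y\<in>I. ennreal \<bar>f y\<bar> \<partial>lebesgue) / emeasure lebesgue I)"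

definition ergodic_best_constant :: "'a measure \<Rightarrow> ('a \<Rightarrow> 'a) \<Rightarrow> real \<Rightarrow> ennreal" where
  "ergodic_best_constant M T p = best_constant p M (ergodic_maximal M T)"

definition HL_best_constant :: "real \<Rightarrow> ennreal" where
  "HL_best_constant p = best_constant p lebesgue HL_maximal"

end

theory Submission
  imports Defs
begin

text \<open>Both best constants are compared with the best constant of the uncentered maximal function on the
  integers. More precisely, for every finite \<open>c \<ge> 0\<close>, the strong type \<open>(p, p)\<close> inequality with constant
  \<open>c\<close> on the line and the one for \<open>T\<close> are both equivalent to a discrete inequality \<open>window_bound p c\<close>,
  which involves only finite windows of a sequence. This is four implications.

  From the line to the integers (\<open>window_bound_if_HL_bound\<close>), a sequence becomes a step function on
  unit cells. From the integers to \<open>T\<close> (\<open>ergodic_bound_if_window_bound\<close>), the discrete inequality is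
  used along finite orbit segments and integrated over the starting point; the boundary effect
  vanishes when the segments grow. From \<open>T\<close> to the integers (\<open>window_bound_if_ergodic_bound\<close>), the
  disjoint preimages of the sets \<open>E\<^sub>L\<close> form towers of arbitrary height, on which any window of a
  sequence can be copied.

  From the integers to the line (\<open>HL_bound_if_window_bound\<close>), a function is replaced by its averages
  over cells of length \<open>1 / K\<close>. This does not increase its norm, by Jensen's inequality. An interval of
  length \<open>l\<close> is covered by adjacent cells of total length at most \<open>l + 2 / K\<close>; hence the lower limit
  of the discrete maximal functions dominates every interval mean, and Fatou's lemma concludes.\<close>

section \<open>Powers and strong type inequalities\<close>

lemma ennpow_ennreal: "0 \<le> a \<Longrightarrow> ennpow (ennreal a) p = ennreal (a powr p)"
  by (simp add: ennpow_def)

lemma ennpow_mono: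
  assumes "0 \<le> p" "x \<le> y"
  shows "ennpow x p \<le> ennpow y p"
  using assms by (cases x; cases y) (auto simp: ennpow_def top_unique intro!: ennreal_leI powr_mono2)

lemma ennpow_powr_inverse:
  assumes "0 < p" "q = 1 / p"
  shows "ennpow (ennpow x p) q = x"
  using assms by (cases x) (auto simp: ennpow_def powr_powr)

text \<open>Raising to the power \<open>p\<close> is an order isomorphism of \<open>[0, \<infinity>]\<close>. This adjunction reduces bounding
  the power of a supremum to bounding the powers of its members.\<close>

lemma ennpow_le_iff:
  assumes "0 < p"
  shows "ennpow x p \<le> y \<longleftrightarrow> x \<le> ennpow y (1 / p)"
proof
  assume "ennpow x p \<le> y"
  then have "ennpow (ennpow x p) (1 / p) \<le> ennpow y (1 / p)"
    using assms by (intro ennpow_mono) auto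
  then show "x \<le> ennpow y (1 / p)" using assms by (simp add: ennpow_powr_inverse)
next
  assume "x \<le> ennpow y (1 / p)"
  then have "ennpow x p \<le> ennpow (ennpow y (1 / p)) p"
    using assms by (intro ennpow_mono) auto
  then show "ennpow x p \<le> y" using assms by (simp add: ennpow_powr_inverse)
qed

lemma ennpow_cmult:
  assumes "0 < p" "0 \<le> c"
  shows "ennpow (ennreal c * x) p = ennreal (c powr p) * ennpow x p"
proof (cases x)
  case (real a)
  then show ?thesis using assms by (simp add: ennpow_ennreal powr_mult flip: ennreal_mult)
next
  case top
  then show ?thesis using assms
    by (cases "c = 0") (auto simp: ennpow_def ennreal_mult_top)
qed

lemma borel_measurable_ennpow [measurable]: "(\<lambda>x. ennpow x p) \<in> borel_measurable borel"
  unfolding ennpow_def by measurable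

text \<open>The outer exponent \<open>1 / p\<close> of both norms cancels; all later estimates are between integrals of
  \<open>p\<close>-th powers.\<close>

lemma strong_type_bound_iff_nn_integral:
  assumes p: "0 < p" and c: "0 \<le> c"
  shows "strong_type_bound p M S (ennreal c) \<longleftrightarrow>
    (\<forall>f\<in>borel_measurable M. (\<integral>\<^sup>+x. ennreal (\<bar>f x\<bar> powr p) \<partial>M) < \<infinity> \<longrightarrow>
       (\<integral>\<^sup>+x. ennpow (S f x) p \<partial>M) \<le> ennreal (c powr p) * (\<integral>\<^sup>+x. ennreal (\<bar>f x\<bar> powr p) \<partial>M))"
proof -
  have fin: "ennpow y (1 / p) < \<infinity> \<longleftrightarrow> y < \<infinity>" for y
    by (cases y) (auto simp: ennpow_def)
  have "Lp_norm p M (S f) \<le> ennreal c * Lp_norm p M (\<lambda>x. ennreal \<bar>f x\<bar>) \<longleftrightarrow>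
     (\<integral>\<^sup>+x. ennpow (S f x) p \<partial>M) \<le> ennreal (c powr p) * (\<integral>\<^sup>+x. ennreal (\<bar>f x\<bar> powr p) \<partial>M)" for f
    using p c ennpow_le_iff[of "1 / p"]
    by (simp add: Lp_norm_def ennpow_ennreal ennpow_cmult ennpow_powr_inverse)
  then show ?thesis
    by (auto simp: strong_type_bound_def Lp_space_def Lp_norm_def fin[unfolded infinity_ennreal_def] ennpow_ennreal)
qed

text \<open>The constant \<open>\<infinity>\<close> never decides the infimum, so only finite constants have to be compared.\<close>

lemma best_constant_cong:
  assumes "\<And>c. 0 \<le> c \<Longrightarrow> strong_type_bound p M S (ennreal c) \<longleftrightarrow> strong_type_bound p N S' (ennreal c)"
  shows "best_constant p M S = best_constant p N S'"
proof -
  have le: "best_constant p M S \<le> best_constant p N S'"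
    if "\<And>c. 0 \<le> c \<Longrightarrow> strong_type_bound p N S' (ennreal c) \<Longrightarrow> strong_type_bound p M S (ennreal c)"
    for M :: "'c measure" and S and N :: "'d measure" and S'
  proof -
    have "best_constant p M S \<le> C" if "strong_type_bound p N S' C" for C
      using that \<open>\<And>c. 0 \<le> c \<Longrightarrow> strong_type_bound p N S' (ennreal c) \<Longrightarrow> strong_type_bound p M S (ennreal c)\<close>
      by (cases C) (auto intro: best_constant_le)
    then show ?thesis unfolding best_constant_def[of p N] by (auto intro: Inf_greatest)
  qed
  show ?thesis using assms by (intro antisym le) auto
qed

section \<open>The discrete maximal inequality\<close>

text \<open>The uncentered maximal function on \<open>\<int>\<close>, with both one-sided radii at most \<open>R\<close>. With this cut-off,
  its values on \<open>{-N..N}\<close> depend only on \<open>g\<close> restricted to \<open>{-(N + R)..N + R}\<close>.\<close>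

definition window_maximal :: "nat \<Rightarrow> (int \<Rightarrow> real) \<Rightarrow> int \<Rightarrow> ennreal" where
  "window_maximal R g n =
     (SUP (r, s)\<in>{..R} \<times> {..R}.
        ennreal ((\<Sum>k = n - int r..n + int s. g k) / (real r + real s + 1)))"

text \<open>The strong type \<open>(p, p)\<close> inequality on \<open>\<int>\<close> with constant \<open>c\<close>, written through finite windows. The
  right-hand side sees only the window on which the left-hand side depends, so the statement
  applies to arbitrary sequences. It is this locality that allows the
  inequality to be evaluated along a finite piece of an orbit.\<close>

definition window_bound :: "real \<Rightarrow> real \<Rightarrow> bool" where
  "window_bound p c \<longleftrightarrow>
     (\<forall>g N R. (\<forall>k. 0 \<le> g k) \<longrightarrow>
        (\<Sum>n = - int N..int N. ennpow (window_maximal R g n) p)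
          \<le> ennreal (c powr p) * (\<Sum>n = - int (N + R)..int (N + R). ennreal (g n powr p)))"

lemma window_boundD:
  assumes "window_bound p c" "\<And>k. 0 \<le> g k"
  shows "(\<Sum>n = - int N..int N. ennpow (window_maximal R g n) p)
    \<le> ennreal (c powr p) * (\<Sum>n = - int (N + R)..int (N + R). ennreal (g n powr p))"
  using assms unfolding window_bound_def by blast

lemma window_maximal_ge:
  assumes "r \<le> R" "s \<le> R"
  shows "ennreal ((\<Sum>k = n - int r..n + int s. g k) / (real r + real s + 1)) \<le> window_maximal R g n"
  unfolding window_maximal_def using assms by (intro SUP_upper2[of "(r, s)"]) auto

lemma window_maximal_leI:
  assumes "\<And>r s. r \<le> R \<Longrightarrow> s \<le> R \<Longrightarrow>
    ennreal ((\<Sum>k = n - int r..n + int s. g k) / (real r + real s + 1)) \<le> y"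
  shows "window_maximal R g n \<le> y"
  unfolding window_maximal_def using assms by (auto intro!: SUP_least)

section \<open>Step functions over disjoint sets\<close>

lemma nn_integral_step:
  assumes "finite I" "\<And>i. i \<in> I \<Longrightarrow> A i \<in> sets M"
  shows "(\<integral>\<^sup>+x. (\<Sum>i\<in>I. c i * indicator (A i) x) \<partial>M) = (\<Sum>i\<in>I. c i * emeasure M (A i))"
  using assms by (subst nn_integral_sum) (auto simp: nn_integral_cmult_indicator)

lemma disjoint_step_eq:
  fixes c :: "'i \<Rightarrow> 'b::semiring_1"
  assumes "finite I" "disjoint_family_on A I" "i \<in> I" "x \<in> A i"
  shows "(\<Sum>j\<in>I. c j * indicator (A j) x) = c i"
proof -
  have "(\<Sum>j\<in>I. c j * indicator (A j) x) = (\<Sum>j\<in>I. if j = i then c j else 0)"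
  proof (intro sum.cong refl)
    fix j assume "j \<in> I"
    then show "c j * indicator (A j) x = (if j = i then c j else 0)"
      using assms disjoint_family_onD[of A I i j] by (auto simp: indicator_def)
  qed
  then show ?thesis using assms by simp
qed

lemma nn_integral_powr_step:
  assumes p: "0 < p" and "finite I" and disj: "disjoint_family_on A I"
    and meas: "\<And>i. i \<in> I \<Longrightarrow> A i \<in> sets M" and nonneg: "\<And>i. i \<in> I \<Longrightarrow> 0 \<le> g i"
  shows "(\<integral>\<^sup>+x. ennreal (\<bar>\<Sum>i\<in>I. g i * indicator (A i) x\<bar> powr p) \<partial>M) =
           (\<Sum>i\<in>I. ennreal (g i powr p) * emeasure M (A i))"
proof -
  have "ennreal (\<bar>\<Sum>i\<in>I. g i * indicator (A i) x\<bar> powr p) =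
      (\<Sum>i\<in>I. ennreal (g i powr p) * indicator (A i) x)" for x
  proof (cases "\<exists>i\<in>I. x \<in> A i")
    case True
    then obtain i where "i \<in> I" "x \<in> A i" by blast
    then show ?thesis using nonneg by (simp add: disjoint_step_eq[OF \<open>finite I\<close> disj])
  next
    case False
    then have "(\<Sum>i\<in>I. g i * indicator (A i) x) = 0"
      "(\<Sum>i\<in>I. ennreal (g i powr p) * indicator (A i) x) = 0"
      by (auto intro!: sum.neutral simp: indicator_def)
    then show ?thesis using p by simp
  qed
  then show ?thesis by (simp only: nn_integral_step \<open>finite I\<close> meas)
qed

text \<open>This follows from monotonicity of the lower integral alone, and hence applies to the maximal function
  on the line, which is a supremum of uncountably many averages.\<close>

lemma nn_integral_ge_step:
  assumes "finite I" and disj: "disjoint_family_on A I"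
    and "\<And>i. i \<in> I \<Longrightarrow> A i \<in> sets M" and ge: "\<And>i x. i \<in> I \<Longrightarrow> x \<in> A i \<Longrightarrow> c i \<le> h x"
  shows "(\<Sum>i\<in>I. c i * emeasure M (A i)) \<le> (\<integral>\<^sup>+x. h x \<partial>M)"
proof -
  have "(\<Sum>i\<in>I. c i * indicator (A i) x) \<le> h x" for x
  proof (cases "\<exists>i\<in>I. x \<in> A i")
    case True
    then show ?thesis using ge by (auto simp: disjoint_step_eq[OF \<open>finite I\<close> disj])
  next
    case False
    then have "(\<Sum>i\<in>I. c i * indicator (A i) x) = 0"
      by (auto intro!: sum.neutral simp: indicator_def)
    then show ?thesis by simp
  qed
  then have "(\<integral>\<^sup>+x. (\<Sum>i\<in>I. c i * indicator (A i) x) \<partial>M) \<le> (\<integral>\<^sup>+x. h x \<partial>M)"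
    by (intro nn_integral_mono)
  then show ?thesis using assms by (simp only: nn_integral_step)
qed

section \<open>From the line to the integers\<close>

lemma emeasure_lebesgue_Ico: "a \<le> b \<Longrightarrow> emeasure lebesgue {a..<b::real} = ennreal (b - a)"
  by (subst emeasure_completion) auto

text \<open>Let \<open>F\<close> take the value \<open>g k\<close> on \<open>{k..<k + 1}\<close>. For \<open>x\<close> in the cell of \<open>n\<close>, the interval
  \<open>{n - r..<n + s + 1}\<close> contains \<open>x\<close>, and the mean of \<open>F\<close> over it is the discrete average of \<open>g\<close>.
  Hence the maximal function of \<open>F\<close> dominates that of \<open>g\<close> on each cell, while the norms of \<open>F\<close> and \<open>g\<close>
  agree.\<close>

lemma window_bound_if_HL_bound:
  assumes p: "0 < p" and c: "0 \<le> c" and bound: "strong_type_bound p lebesgue HL_maximal (ennreal c)"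
  shows "window_bound p c"
  unfolding window_bound_def
proof (intro allI impI)
  fix g :: "int \<Rightarrow> real" and N R :: nat
  assume g: "\<forall>k. 0 \<le> g k"
  define W where "W = {- int (N + R)..int (N + R)}"
  define Q where "Q k = {real_of_int k..<real_of_int k + 1}" for k
  define F where "F x = (\<Sum>k\<in>W. g k * indicator (Q k) x)" for x
  have Q_disj: "disjoint_family_on Q I" for I
    unfolding disjoint_family_on_def Q_def by (auto simp: less_le_not_le)
  have Q_sets [measurable, simp]: "Q k \<in> sets lebesgue" for k by (simp add: Q_def)
  have Q_measure [simp]: "emeasure lebesgue (Q k) = 1" for k
    by (simp add: Q_def emeasure_lebesgue_Ico)
  have F_meas: "F \<in> borel_measurable lebesgue"
    unfolding F_def by measurable
  have F_norm: "(\<integral>\<^sup>+x. ennreal (\<bar>F x\<bar> powr p) \<partial>lebesgue) = (\<Sum>k\<in>W. ennreal (g k powr p))"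
    unfolding F_def using p g by (subst nn_integral_powr_step) (auto simp: W_def Q_disj)
  have "window_maximal R g n \<le> HL_maximal F x" if n: "n \<in> {- int N..int N}" and x: "x \<in> Q n" for n x
  proof (rule window_maximal_leI)
    fix r s assume rs: "r \<le> R" "s \<le> R"
    define J where "J = {n - int r..n + int s}"
    define I where "I = {real_of_int (n - int r)..<real_of_int (n + int s + 1)}"
    have JW: "J \<subseteq> W" using n rs by (auto simp: J_def W_def)
    have QI: "Q k \<subseteq> I" if "k \<in> J" for k
      using that by (auto simp: Q_def I_def J_def; linarith)
    have I_measure: "emeasure lebesgue I = ennreal (real r + real s + 1)"
      unfolding I_def by (subst emeasure_lebesgue_Ico) (auto simp: algebra_simps)
    have "(\<Sum>k\<in>J. ennreal (g k)) = (\<Sum>k\<in>J. ennreal (g k) * emeasure lebesgue (Q k))" by simp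
    also have "\<dots> \<le> (\<integral>\<^sup>+y. ennreal \<bar>F y\<bar> * indicator I y \<partial>lebesgue)"
    proof (rule nn_integral_ge_step)
      fix k y assume k: "k \<in> J" "y \<in> Q k"
      then have "F y = g k" unfolding F_def using JW by (intro disjoint_step_eq Q_disj) (auto simp: W_def)
      then show "ennreal (g k) \<le> ennreal \<bar>F y\<bar> * indicator I y" using QI[OF k(1)] k g by (simp add: subset_iff)
    qed (auto simp: J_def Q_disj)
    finally have int: "ennreal (\<Sum>k\<in>J. g k) \<le> (\<integral>\<^sup>+y\<in>I. ennreal \<bar>F y\<bar> \<partial>lebesgue)"
      using g by (simp add: sum_ennreal)
    have "ennreal ((\<Sum>k\<in>J. g k) / (real r + real s + 1)) = ennreal (\<Sum>k\<in>J. g k) / emeasure lebesgue I"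
      unfolding I_measure using g by (intro divide_ennreal[symmetric]) (auto intro: sum_nonneg)
    also have "\<dots> \<le> (\<integral>\<^sup>+y\<in>I. ennreal \<bar>F y\<bar> \<partial>lebesgue) / emeasure lebesgue I"
      using int by (rule divide_right_mono_ennreal)
    also have "\<dots> \<le> HL_maximal F x"
      unfolding HL_maximal_def
    proof (rule SUP_upper, safe)
      show "is_interval I" "bounded I" unfolding I_def by (auto intro: bounded_Ico is_interval_co)
      show "0 < emeasure lebesgue I" by (simp add: I_measure ennreal_less_zero_iff del: ennreal_plus)
      show "x \<in> I" using x QI[of n] by (auto simp: J_def)
    qed
    finally show "ennreal ((\<Sum>k = n - int r..n + int s. g k) / (real r + real s + 1)) \<le> HL_maximal F x"
      by (simp add: J_def)
  qed
  then have "(\<Sum>n = - int N..int N. ennpow (window_maximal R g n) p * emeasure lebesgue (Q n))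
      \<le> (\<integral>\<^sup>+x. ennpow (HL_maximal F x) p \<partial>lebesgue)"
    using p by (intro nn_integral_ge_step Q_disj ennpow_mono) auto
  also have "\<dots> \<le> ennreal (c powr p) * (\<Sum>k\<in>W. ennreal (g k powr p))"
    using bound F_meas unfolding strong_type_bound_iff_nn_integral[OF p c] F_norm[symmetric]
    by (auto simp: F_norm W_def sum_ennreal)
  finally show "(\<Sum>n = - int N..int N. ennpow (window_maximal R g n) p)
          \<le> ennreal (c powr p) * (\<Sum>n = - int (N + R)..int (N + R). ennreal (g n powr p))"
    by (simp add: W_def)
qed

section \<open>Iterates of an invertible measure-preserving map\<close>

lemma measure_preserving_funpow:
  assumes "measure_preserving M f"
  shows "measure_preserving M (f ^^ k)"
proof (induction k)
  case 0
  then show ?case by (auto simp: measure_preserving_def intro!: arg_cong2[where f = emeasure] dest: sets.sets_into_space)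
next
  case (Suc k)
  have [measurable]: "f \<in> measurable M M" "f ^^ k \<in> measurable M M"
    using assms Suc by (auto simp: measure_preserving_def)
  have "(f ^^ Suc k) -` E \<inter> space M = (f ^^ k) -` (f -` E \<inter> space M) \<inter> space M" for E
    using measurable_space[of "f ^^ k" M M] by auto
  moreover have "f -` E \<inter> space M \<in> sets M" if "E \<in> sets M" for E
    using that by measurable
  moreover have "f ^^ Suc k \<in> measurable M M" by simp
  ultimately show ?case using assms Suc unfolding measure_preserving_def by metis
qed

locale invertible_measure_preserving =
  fixes M :: "'a measure" and T :: "'a \<Rightarrow> 'a"
  assumes preserving: "measure_preserving M T" and invertible: "invertible_on_space M T"
begin

lemma measure_preserving_inverse: "measure_preserving M (inv_into (space M) T)"
proof -
  let ?S = "inv_into (space M) T"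
  have T [measurable]: "T \<in> measurable M M" and S [measurable]: "?S \<in> measurable M M"
    and bij: "bij_betw T (space M) (space M)"
    using preserving invertible by (auto simp: measure_preserving_def invertible_on_space_def)
  have "emeasure M (?S -` E \<inter> space M) = emeasure M E" if [measurable]: "E \<in> sets M" for E
  proof -
    have "E = T -` (?S -` E \<inter> space M) \<inter> space M"
      using bij sets.sets_into_space[OF that]
      by (auto simp: bij_betw_inv_into_left bij_betw_apply)
    moreover have "?S -` E \<inter> space M \<in> sets M" by measurable
    ultimately show ?thesis using preserving unfolding measure_preserving_def by metis
  qed
  then show ?thesis by (simp add: measure_preserving_def)
qed

lemma measure_preserving_int_iterate: "measure_preserving M (int_iterate M T n)"
  by (simp add: int_iterate_def measure_preserving_funpow preserving measure_preserving_inverse)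

lemma measurable_int_iterate [measurable]: "int_iterate M T n \<in> measurable M M"
  using measure_preserving_int_iterate by (simp add: measure_preserving_def)

lemma int_iterate_space: "x \<in> space M \<Longrightarrow> int_iterate M T n x \<in> space M"
  using measurable_space[OF measurable_int_iterate] .

lemma nn_integral_int_iterate:
  assumes "h \<in> borel_measurable M"
  shows "(\<integral>\<^sup>+x. h (int_iterate M T n x) \<partial>M) = (\<integral>\<^sup>+x. h x \<partial>M)"
proof -
  have "distr M M (int_iterate M T n) = M"
    using measure_preserving_int_iterate[of n]
    by (intro measure_eqI) (auto simp: measure_preserving_def emeasure_distr)
  then show ?thesis
    using nn_integral_distr[of "int_iterate M T n" M M h] assms by simp
qed

lemma int_iterate_0 [simp]: "int_iterate M T 0 x = x"
  by (simp add: int_iterate_def)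

lemma int_iterate_step:
  assumes x: "x \<in> space M"
  shows "int_iterate M T (n + 1) x = T (int_iterate M T n x)"
proof (cases "0 \<le> n")
  case True
  then have "nat (n + 1) = Suc (nat n)" by simp
  then show ?thesis using True by (simp add: int_iterate_def)
next
  case False
  let ?S = "inv_into (space M) T"
  define m where "m = nat (- n - 1)"
  have m: "nat (- n) = Suc m" "nat (- (n + 1)) = m" using False by (auto simp: m_def)
  have next_eq: "int_iterate M T (n + 1) x = (?S ^^ m) x"
    using False m by (cases "n = -1") (auto simp: int_iterate_def)
  have "(?S ^^ m) x \<in> space M"
    using int_iterate_space[OF x, of "n + 1"] next_eq by simp
  then have "T (?S ((?S ^^ m) x)) = (?S ^^ m) x"
    using invertible by (auto simp: invertible_on_space_def bij_betw_inv_into_right)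
  then show ?thesis using False m next_eq by (simp add: int_iterate_def)
qed

lemma int_iterate_add:
  assumes x: "x \<in> space M"
  shows "int_iterate M T (m + n) x = int_iterate M T m (int_iterate M T n x)"
proof (induction m rule: int_induct[where k = 0])
  case base
  then show ?case by simp
next
  case (step1 i)
  then show ?case
    using int_iterate_step[OF x, of "i + n"] int_iterate_step[OF int_iterate_space[OF x], of i n]
    by (simp add: algebra_simps)
next
  case (step2 i)
  have "T (int_iterate M T (i - 1 + n) x) = T (int_iterate M T (i - 1) (int_iterate M T n x))"
    using step2 int_iterate_step[OF x, of "i - 1 + n"]
      int_iterate_step[OF int_iterate_space[OF x], of "i - 1" n]
    by (simp add: algebra_simps)
  moreover have "inj_on T (space M)"
    using invertible by (auto simp: invertible_on_space_def bij_betw_def)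
  ultimately show ?case
    by (meson inj_onD int_iterate_space x)
qed

end

section \<open>Transference between the integers and the dynamical system\<close>

text \<open>The loss \<open>(2 (N + R) + 1) / (2 N + 1)\<close> of the transference argument tends to \<open>1\<close> as \<open>N\<close> grows.
  Finiteness of \<open>b\<close> excludes the case \<open>a = \<infinity>\<close>, through \<open>N = 0\<close>.\<close>

lemma le_if_averaged_le:
  fixes a b :: ennreal
  assumes b: "b < \<infinity>" and le: "\<And>N. ennreal (2 * real N + 1) * a \<le> ennreal (2 * real (N + R) + 1) * b"
  shows "a \<le> b"
proof -
  obtain b' where b': "b = ennreal b'" "0 \<le> b'" using b by (cases b) auto
  have "a \<le> ennreal (2 * real R + 1) * b" using le[of 0] by simp
  also have "\<dots> < \<infinity>" using b' by (simp only: infinity_ennreal_def ennreal_mult_less_top) simp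
  finally obtain a' where a': "a = ennreal a'" "0 \<le> a'" by (cases a) auto
  have le': "(2 * real N + 1) * a' \<le> (2 * real (N + R) + 1) * b'" for N
  proof -
    have "ennreal ((2 * real N + 1) * a') \<le> ennreal ((2 * real (N + R) + 1) * b')"
      using le[of N] a' b' by (simp add: ennreal_mult)
    then show ?thesis using b' by (subst (asm) ennreal_le_iff) auto
  qed
  have "a' \<le> b'"
  proof (rule ccontr)
    assume "\<not> a' \<le> b'"
    then obtain N :: nat where "2 * real R * b' < real N * (a' - b')"
      using reals_Archimedean3[of "a' - b'"] by auto
    moreover have "0 \<le> (real N + 1) * (a' - b')" using \<open>\<not> a' \<le> b'\<close> by simp
    ultimately show False using le'[of N] by (simp add: algebra_simps)
  qed
  then show ?thesis using a' b' by (simp add: ennreal_leI)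
qed

context invertible_measure_preserving
begin

lemma window_maximal_orbit:
  assumes x: "x \<in> space M"
  shows "window_maximal R (\<lambda>k. \<bar>f (int_iterate M T k x)\<bar>) n =
         window_maximal R (\<lambda>k. \<bar>f (int_iterate M T k (int_iterate M T n x))\<bar>) 0"
proof -
  have "(\<Sum>k = n - int r..n + int s. \<bar>f (int_iterate M T k x)\<bar>) =
      (\<Sum>k = 0 - int r..0 + int s. \<bar>f (int_iterate M T k (int_iterate M T n x))\<bar>)" for r s
    by (rule sum.reindex_bij_witness[of _ "\<lambda>k. k + n" "\<lambda>k. k - n"])
       (auto simp: x simp flip: int_iterate_add)
  then show ?thesis unfolding window_maximal_def by simp
qed

text \<open>Calderon's transference. Apply the discrete inequality to the orbit values
  \<open>\<bar>f (T\<^sup>k x)\<bar>\<close> of each point and integrate over \<open>x\<close>. Because \<open>T\<close> preserves the measure, each of the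
  \<open>2 N + 1\<close> terms on the left integrates to the same number, as does each of the
  \<open>2 (N + R) + 1\<close> terms on the right. Letting first \<open>N\<close> and then \<open>R\<close> tend to infinity gives the claim.\<close>

lemma ergodic_bound_if_window_bound:
  assumes p: "0 < p" and c: "0 \<le> c" and wb: "window_bound p c"
  shows "strong_type_bound p M (ergodic_maximal M T) (ennreal c)"
  unfolding strong_type_bound_iff_nn_integral[OF p c]
proof (intro ballI impI)
  fix f :: "'a \<Rightarrow> real"
  assume [measurable]: "f \<in> borel_measurable M"
    and fin: "(\<integral>\<^sup>+x. ennreal (\<bar>f x\<bar> powr p) \<partial>M) < \<infinity>"
  define I where "I = (\<integral>\<^sup>+x. ennreal (\<bar>f x\<bar> powr p) \<partial>M)"
  define g where "g x k = \<bar>f (int_iterate M T k x)\<bar>" for x k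
  define A where "A R x = ennpow (window_maximal R (g x) 0) p" for R x
  have [measurable]: "A R \<in> borel_measurable M" for R
    unfolding A_def g_def window_maximal_def by measurable
  have A_int: "(\<integral>\<^sup>+x. A R x \<partial>M) \<le> ennreal (c powr p) * I" for R
  proof (rule le_if_averaged_le)
    show "ennreal (c powr p) * I < \<infinity>"
      using fin by (simp add: I_def ennreal_mult_less_top)
    fix N
    have card: "of_nat (card {- int m..int m}) = ennreal (2 * real m + 1)" for m
      by (simp add: ennreal_of_nat_eq_real_of_nat)
    have "ennreal (2 * real N + 1) * (\<integral>\<^sup>+x. A R x \<partial>M) =
        (\<Sum>n = - int N..int N. \<integral>\<^sup>+x. A R (int_iterate M T n x) \<partial>M)"
      by (simp only: nn_integral_int_iterate sum_constant card \<open>A R \<in> borel_measurable M\<close>)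
    also have "\<dots> = (\<integral>\<^sup>+x. (\<Sum>n = - int N..int N. A R (int_iterate M T n x)) \<partial>M)"
      by (rule nn_integral_sum[symmetric]) measurable
    also have "\<dots> \<le> (\<integral>\<^sup>+x. ennreal (c powr p) *
        (\<Sum>n = - int (N + R)..int (N + R). ennreal (\<bar>f (int_iterate M T n x)\<bar> powr p)) \<partial>M)"
    proof (rule nn_integral_mono)
      fix x assume "x \<in> space M"
      then have "A R (int_iterate M T n x) = ennpow (window_maximal R (g x) n) p" for n
        unfolding A_def g_def by (subst (2) window_maximal_orbit) auto
      then show "(\<Sum>n = - int N..int N. A R (int_iterate M T n x)) \<le> ennreal (c powr p) *
        (\<Sum>n = - int (N + R)..int (N + R). ennreal (\<bar>f (int_iterate M T n x)\<bar> powr p))"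
        using window_boundD[OF wb, of "g x" R N] by (simp add: g_def)
    qed
    also have "\<dots> = ennreal (c powr p) *
        (\<Sum>n = - int (N + R)..int (N + R). \<integral>\<^sup>+x. ennreal (\<bar>f (int_iterate M T n x)\<bar> powr p) \<partial>M)"
      by (subst nn_integral_cmult, measurable) (subst nn_integral_sum, auto)
    also have "\<dots> = ennreal (c powr p) * (\<Sum>n = - int (N + R)..int (N + R). I)"
      using nn_integral_int_iterate[of "\<lambda>x. ennreal (\<bar>f x\<bar> powr p)"] by (simp add: I_def)
    also have "\<dots> = ennreal (2 * real (N + R) + 1) * (ennreal (c powr p) * I)"
      by (simp only: sum_constant card ac_simps)
    finally show "ennreal (2 * real N + 1) * (\<integral>\<^sup>+x. A R x \<partial>M)
      \<le> ennreal (2 * real (N + R) + 1) * (ennreal (c powr p) * I)" .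
  qed
  have "ennpow (ergodic_maximal M T f x) p \<le> (SUP R. A R x)" for x
    unfolding ennpow_le_iff[OF p] ergodic_maximal_def
  proof (rule SUP_least, clarify)
    fix r s :: nat
    define R where "R = max r s"
    have "ennreal \<bar>1 / (real r + real s + 1) * (\<Sum>n = - int r..int s. f (int_iterate M T n x))\<bar>
      \<le> ennreal ((\<Sum>k = 0 - int r..0 + int s. g x k) / (real r + real s + 1))"
      unfolding g_def by (intro ennreal_leI) (simp add: abs_mult divide_right_mono sum_abs)
    also have "\<dots> \<le> window_maximal R (g x) 0"
      by (rule window_maximal_ge) (auto simp: R_def)
    also have "\<dots> \<le> ennpow (SUP R. A R x) (1 / p)"
      unfolding ennpow_le_iff[OF p, symmetric] A_def[symmetric] by (rule SUP_upper) simp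
    finally show "ennreal \<bar>1 / (real r + real s + 1) * (\<Sum>n = - int r..int s. f (int_iterate M T n x))\<bar>
      \<le> ennpow (SUP R. A R x) (1 / p)" .
  qed
  then have "(\<integral>\<^sup>+x. ennpow (ergodic_maximal M T f x) p \<partial>M) \<le> (\<integral>\<^sup>+x. (SUP R. A R x) \<partial>M)"
    by (intro nn_integral_mono)
  also have "\<dots> = (SUP R. \<integral>\<^sup>+x. A R x \<partial>M)"
  proof (rule nn_integral_monotone_convergence_SUP)
    have "window_maximal R g' n \<le> window_maximal R' g' n" if "R \<le> R'" for R R' g' n
      using that by (intro window_maximal_leI window_maximal_ge) auto
    then show "incseq A"
      unfolding A_def using p by (auto simp: incseq_def le_fun_def intro!: ennpow_mono)
  qed measurable
  also have "\<dots> \<le> ennreal (c powr p) * I"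
    using A_int by (rule SUP_least)
  finally show "(\<integral>\<^sup>+x. ennpow (ergodic_maximal M T f x) p \<partial>M)
    \<le> ennreal (c powr p) * (\<integral>\<^sup>+x. ennreal (\<bar>f x\<bar> powr p) \<partial>M)" by (simp add: I_def)
qed

text \<open>A sequence on a window is copied to \<open>X\<close> along a tower of \<open>2 (N + R) + 1\<close> disjoint sets, the function
  having the value \<open>g n\<close> on level \<open>n\<close>. As \<open>T\<close> maps each level to the next one, the ergodic averages at
  a point of level \<open>n\<close> with \<open>\<bar>n\<bar> \<le> N\<close> and with radii at most \<open>R\<close> are the averages of \<open>g\<close> around \<open>n\<close>. All levels have measure \<open>\<mu>(E)\<close>, which is
  positive and finite and therefore cancels.\<close>

lemma window_bound_if_ergodic_bound:
  assumes p: "0 < p" and c: "0 \<le> c"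
    and bound: "strong_type_bound p M (ergodic_maximal M T) (ennreal c)"
    and towers: "\<And>L :: nat. 1 \<le> L \<Longrightarrow>
           \<exists>E\<in>sets M. 0 < emeasure M E \<and> emeasure M E < \<infinity> \<and>
             disjoint_family_on (\<lambda>l. (T ^^ l) -` E \<inter> space M) {1..L}"
  shows "window_bound p c"
  unfolding window_bound_def
proof (intro allI impI)
  fix g :: "int \<Rightarrow> real" and N R :: nat
  assume g: "\<forall>k. 0 \<le> g k"
  define W where "W = {- int (N + R)..int (N + R)}"
  obtain E where E [measurable]: "E \<in> sets M" and E_measure: "0 < emeasure M E" "emeasure M E < \<infinity>"
    and E_disj: "disjoint_family_on (\<lambda>l. (T ^^ l) -` E \<inter> space M) {1..2 * (N + R) + 1}"
    using towers[of "2 * (N + R) + 1"] by auto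
  \<comment> \<open>Level \<open>n\<close> consists of the points that are in \<open>E\<close> at time \<open>N + R + 1 - n\<close>. The sign makes \<open>T\<close> raise the
    level by one; the shift makes the times for \<open>n \<in> W\<close> fill \<open>{1..2 (N + R) + 1}\<close>.\<close>
  define Q where "Q n = int_iterate M T (int (N + R) + 1 - n) -` E \<inter> space M" for n
  define F where "F x = (\<Sum>n\<in>W. g n * indicator (Q n) x)" for x
  have Q_disj: "disjoint_family_on Q W"
    unfolding disjoint_family_on_def
  proof (intro ballI impI)
    fix m n assume "m \<in> W" "n \<in> W" "m \<noteq> n"
    moreover define i j where "i = nat (int (N + R) + 1 - m)" and "j = nat (int (N + R) + 1 - n)"
    ultimately have "i \<noteq> j" "i \<in> {1..2 * (N + R) + 1}" "j \<in> {1..2 * (N + R) + 1}"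
      by (auto simp: W_def)
    moreover have "Q m = (T ^^ i) -` E \<inter> space M" "Q n = (T ^^ j) -` E \<inter> space M"
      using \<open>m \<in> W\<close> \<open>n \<in> W\<close> by (auto simp: Q_def int_iterate_def i_def j_def W_def)
    ultimately show "Q m \<inter> Q n = {}"
      using disjoint_family_onD[OF E_disj] by auto
  qed
  have Q_sets [measurable, simp]: "Q n \<in> sets M" for n
    unfolding Q_def by measurable
  have Q_measure: "emeasure M (Q n) = emeasure M E" for n
    using measure_preserving_int_iterate unfolding Q_def measure_preserving_def by simp
  have F_meas: "F \<in> borel_measurable M"
    unfolding F_def by measurable
  have "(\<integral>\<^sup>+x. ennreal (\<bar>F x\<bar> powr p) \<partial>M) = (\<Sum>n\<in>W. ennreal (g n powr p) * emeasure M (Q n))"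
    unfolding F_def using p g Q_disj by (intro nn_integral_powr_step) (auto simp: W_def)
  then have F_norm: "(\<integral>\<^sup>+x. ennreal (\<bar>F x\<bar> powr p) \<partial>M) =
      (\<Sum>n\<in>W. ennreal (g n powr p)) * emeasure M E"
    by (simp only: Q_measure sum_distrib_right)
  have "window_maximal R g n \<le> ergodic_maximal M T F x"
    if n: "n \<in> {- int N..int N}" and x: "x \<in> Q n" for n x
  proof (rule window_maximal_leI)
    fix r s assume rs: "r \<le> R" "s \<le> R"
    have F_eq: "F (int_iterate M T k x) = g (n + k)" if k: "k \<in> {- int r..int s}" for k
      unfolding F_def
    proof (rule disjoint_step_eq[OF _ Q_disj])
      show "n + k \<in> W" using k n rs by (auto simp: W_def)
      have "x \<in> space M" using x by (simp add: Q_def)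
      then show "int_iterate M T k x \<in> Q (n + k)"
        using x int_iterate_add[of x "int (N + R) + 1 - (n + k)" k]
        by (simp add: Q_def int_iterate_space algebra_simps)
    qed (simp add: W_def)
    have "(\<Sum>k = n - int r..n + int s. g k) = (\<Sum>k = - int r..int s. F (int_iterate M T k x))"
      by (rule sum.reindex_bij_witness[of _ "\<lambda>k. n + k" "\<lambda>k. k - n"]) (auto simp: F_eq)
    moreover have "0 \<le> (\<Sum>k = n - int r..n + int s. g k)" using g by (simp add: sum_nonneg)
    ultimately have "ennreal ((\<Sum>k = n - int r..n + int s. g k) / (real r + real s + 1)) =
       ennreal \<bar>1 / (real r + real s + 1) * (\<Sum>k = - int r..int s. F (int_iterate M T k x))\<bar>"
      by (simp add: abs_mult)
    also have "\<dots> \<le> ergodic_maximal M T F x"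
      unfolding ergodic_maximal_def by (rule SUP_upper2[of "(r, s)"]) auto
    finally show "ennreal ((\<Sum>k = n - int r..n + int s. g k) / (real r + real s + 1))
      \<le> ergodic_maximal M T F x" .
  qed
  then have "(\<Sum>n = - int N..int N. ennpow (window_maximal R g n) p * emeasure M (Q n))
      \<le> (\<integral>\<^sup>+x. ennpow (ergodic_maximal M T F x) p \<partial>M)"
    using p by (intro nn_integral_ge_step disjoint_family_on_mono[OF _ Q_disj] ennpow_mono) (auto simp: W_def)
  also have "\<dots> \<le> ennreal (c powr p) * (\<integral>\<^sup>+x. ennreal (\<bar>F x\<bar> powr p) \<partial>M)"
    using bound F_meas unfolding strong_type_bound_iff_nn_integral[OF p c]
    by (auto simp: F_norm W_def sum_ennreal E_measure[unfolded infinity_ennreal_def] ennreal_mult_less_top)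
  finally have "emeasure M E * (\<Sum>n = - int N..int N. ennpow (window_maximal R g n) p)
      \<le> emeasure M E * (ennreal (c powr p) * (\<Sum>n\<in>W. ennreal (g n powr p)))"
    by (simp only: Q_measure F_norm sum_distrib_left sum_distrib_right ac_simps)
  then show "(\<Sum>n = - int N..int N. ennpow (window_maximal R g n) p)
          \<le> ennreal (c powr p) * (\<Sum>n = - int (N + R)..int (N + R). ennreal (g n powr p))"
    using E_measure by (simp add: ennreal_mult_le_mult_iff W_def)
qed

end

section \<open>Mean values of \<open>p\<close>-integrable functions\<close>

text \<open>The graph of \<open>t powr p\<close> lies above its tangent at \<open>b\<close>; equivalently, Young's inequality for \<open>t\<close>
  and \<open>b powr (p - 1)\<close>. Integrated over a set with \<open>b\<close> the mean value, it yields Jensen's inequality;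
  with \<open>b = 1\<close>, it yields local integrability.\<close>

lemma powr_tangent:
  fixes t b p :: real
  assumes p: "1 < p" and t: "0 \<le> t" and b: "0 \<le> b"
  shows "p * b powr (p - 1) * t \<le> t powr p + (p - 1) * b powr p"
proof -
  define q where "q = p / (p - 1)"
  have q: "1 < q" "1 / p + 1 / q = 1" "(p - 1) * q = p" using p by (auto simp: q_def field_simps)
  have "t * b powr (p - 1) \<le> t powr p / p + (b powr (p - 1)) powr q / q"
    using p q t by (intro Youngs_inequality) auto
  also have "(b powr (p - 1)) powr q / q = b powr p * (p - 1) / p"
    using q p by (simp add: powr_powr) (simp add: q_def)
  finally have "p * (t * b powr (p - 1)) \<le> p * (t powr p / p + b powr p * (p - 1) / p)"
    using p by (intro mult_left_mono) auto
  also have "\<dots> = t powr p + (p - 1) * b powr p" using p by (simp add: field_simps)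
  finally show ?thesis by (simp add: mult_ac)
qed

lemma set_nn_integral_powr_tangent:
  fixes f :: "'a \<Rightarrow> real"
  assumes p: "1 < p" and b: "0 \<le> b"
    and [measurable]: "f \<in> borel_measurable M" "Q \<in> sets M"
  shows "ennreal (p * b powr (p - 1)) * (\<integral>\<^sup>+x\<in>Q. ennreal \<bar>f x\<bar> \<partial>M)
    \<le> (\<integral>\<^sup>+x\<in>Q. ennreal (\<bar>f x\<bar> powr p) \<partial>M) + ennreal ((p - 1) * b powr p) * emeasure M Q"
proof -
  have "ennreal (p * b powr (p - 1)) * (\<integral>\<^sup>+x\<in>Q. ennreal \<bar>f x\<bar> \<partial>M)
      = (\<integral>\<^sup>+x. ennreal (p * b powr (p - 1)) * (ennreal \<bar>f x\<bar> * indicator Q x) \<partial>M)"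
    by (rule nn_integral_cmult[symmetric]) measurable
  also have "\<dots> \<le> (\<integral>\<^sup>+x. ennreal (\<bar>f x\<bar> powr p) * indicator Q x +
      ennreal ((p - 1) * b powr p) * indicator Q x \<partial>M)"
    using p b powr_tangent[OF p abs_ge_zero b]
    by (intro nn_integral_mono)
       (auto simp: indicator_def simp flip: ennreal_mult ennreal_plus intro!: ennreal_leI)
  also have "\<dots> = (\<integral>\<^sup>+x\<in>Q. ennreal (\<bar>f x\<bar> powr p) \<partial>M) + ennreal ((p - 1) * b powr p) * emeasure M Q"
    by (subst nn_integral_add) (auto simp: nn_integral_cmult_indicator)
  finally show ?thesis .
qed

lemma set_nn_integral_finite_if_powr_finite:
  fixes f :: "'a \<Rightarrow> real"
  assumes p: "1 < p" and meas: "f \<in> borel_measurable M" "Q \<in> sets M"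
    and fin: "emeasure M Q < \<infinity>" "(\<integral>\<^sup>+x. ennreal (\<bar>f x\<bar> powr p) \<partial>M) < \<infinity>"
  shows "(\<integral>\<^sup>+x\<in>Q. ennreal \<bar>f x\<bar> \<partial>M) < \<infinity>"
proof -
  have "(\<integral>\<^sup>+x\<in>Q. ennreal (\<bar>f x\<bar> powr p) \<partial>M) \<le> (\<integral>\<^sup>+x. ennreal (\<bar>f x\<bar> powr p) \<partial>M)"
    by (intro nn_integral_mono) (auto simp: indicator_def)
  then have "(\<integral>\<^sup>+x\<in>Q. ennreal (\<bar>f x\<bar> powr p) \<partial>M) + ennreal ((p - 1) * 1 powr p) * emeasure M Q < \<infinity>"
    using fin by (auto simp: ennreal_mult_less_top)
  with set_nn_integral_powr_tangent[OF p zero_le_one meas]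
  have "ennreal (p * 1 powr (p - 1)) * (\<integral>\<^sup>+x\<in>Q. ennreal \<bar>f x\<bar> \<partial>M) < \<infinity>"
    by (rule le_less_trans)
  then show ?thesis using p by (auto simp: ennreal_mult_less_top)
qed

text \<open>Jensen's inequality for the power \<open>p\<close> and the mean over \<open>Q\<close>. Taking for \<open>b\<close> the mean \<open>a / m\<close> in the
  tangent inequality leaves \<open>b powr p * m\<close> on the left after cancellation.\<close>

lemma average_powr_le:
  fixes f :: "'a \<Rightarrow> real"
  assumes p: "1 < p" and meas: "f \<in> borel_measurable M" "Q \<in> sets M"
    and Q: "emeasure M Q = ennreal m" "0 < m"
    and a: "(\<integral>\<^sup>+x\<in>Q. ennreal \<bar>f x\<bar> \<partial>M) = ennreal a" "0 \<le> a"
  shows "ennreal ((a / m) powr p) * ennreal m \<le> (\<integral>\<^sup>+x\<in>Q. ennreal (\<bar>f x\<bar> powr p) \<partial>M)"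
proof -
  define b where "b = a / m"
  have b: "0 \<le> b" "a = b * m" using Q a by (auto simp: b_def)
  have *: "ennreal (p * b powr (p - 1)) * ennreal a
    \<le> (\<integral>\<^sup>+x\<in>Q. ennreal (\<bar>f x\<bar> powr p) \<partial>M) + ennreal ((p - 1) * b powr p) * ennreal m"
    using set_nn_integral_powr_tangent[OF p b(1) meas] unfolding Q(1) a(1) .
  have "b powr (p - 1) * b = b powr p"
    using b(1) by (cases "b = 0") (auto simp: powr_diff)
  then have "p * b powr (p - 1) * a = p * b powr p * m" by (simp add: b(2) mult_ac)
  then have lhs: "ennreal (p * b powr (p - 1)) * ennreal a = ennreal (p * b powr p * m)"
    by (simp only: ennreal_mult''[OF a(2), symmetric])
  show ?thesis
  proof (cases "\<integral>\<^sup>+x\<in>Q. ennreal (\<bar>f x\<bar> powr p) \<partial>M")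
    case (real J)
    then have "p * b powr p * m \<le> J + (p - 1) * b powr p * m"
      using * p Q(2) unfolding lhs
      by (simp add: ennreal_le_iff flip: ennreal_mult ennreal_plus)
    then have "b powr p * m \<le> J" by (simp add: algebra_simps)
    then show ?thesis using real Q(2) by (simp add: b_def ennreal_leI flip: ennreal_mult)
  qed simp
qed

lemma sum_set_nn_integral_le:
  fixes h :: "'a \<Rightarrow> ennreal"
  assumes "finite I" and disj: "disjoint_family_on A I"
    and [measurable]: "h \<in> borel_measurable M" "\<And>i. i \<in> I \<Longrightarrow> A i \<in> sets M"
  shows "(\<Sum>i\<in>I. \<integral>\<^sup>+x\<in>A i. h x \<partial>M) \<le> (\<integral>\<^sup>+x. h x \<partial>M)"
proof -
  have "(\<Sum>i\<in>I. h x * indicator (A i) x) \<le> h x" for x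
  proof (cases "\<exists>i\<in>I. x \<in> A i")
    case True
    then show ?thesis by (auto simp: disjoint_step_eq[OF \<open>finite I\<close> disj])
  next
    case False
    then have "(\<Sum>i\<in>I. h x * indicator (A i) x) = 0"
      by (auto intro!: sum.neutral simp: indicator_def)
    then show ?thesis by simp
  qed
  then show ?thesis
    by (subst nn_integral_sum[symmetric]) (auto intro!: nn_integral_mono)
qed

section \<open>From the integers to the line\<close>

lemma interval_length_le_emeasure:
  fixes I :: "real set"
  assumes I: "is_interval I" "I \<in> sets lebesgue" and ne: "I \<noteq> {}" and bdd: "bounded I"
  shows "ennreal (Sup I - Inf I) \<le> emeasure lebesgue I"
proof -
  have "{Inf I<..<Sup I} \<subseteq> I"
  proof
    fix y assume y: "y \<in> {Inf I<..<Sup I}"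
    obtain a where "a \<in> I" "a < y"
      using y cInf_less_iff[OF ne bounded_imp_bdd_below[OF bdd], of y] by auto
    moreover obtain b where "b \<in> I" "y < b"
      using y less_cSup_iff[OF ne bounded_imp_bdd_above[OF bdd], of y] by auto
    ultimately show "y \<in> I"
      using I(1) unfolding is_interval_1 by (meson less_imp_le)
  qed
  then have "emeasure lebesgue {Inf I<..<Sup I} \<le> emeasure lebesgue I"
    using I by (intro emeasure_mono) auto
  moreover have "emeasure lebesgue {Inf I<..<Sup I} = ennreal (Sup I - Inf I)"
    using cInf_le_cSup[OF ne bounded_imp_bdd_above[OF bdd] bounded_imp_bdd_below[OF bdd]]
    by (subst emeasure_completion) auto
  ultimately show ?thesis by simp
qed

definition cell :: "nat \<Rightarrow> int \<Rightarrow> real set" where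
  "cell K k = {real_of_int k / real K..<(real_of_int k + 1) / real K}"

lemma mem_cell_iff: "0 < K \<Longrightarrow> y \<in> cell K k \<longleftrightarrow> \<lfloor>real K * y\<rfloor> = k"
  by (auto simp: cell_def floor_eq_iff field_simps)

lemma sets_cell [measurable, simp]: "cell K k \<in> sets lebesgue"
  by (simp add: cell_def)

lemma emeasure_cell: "0 < K \<Longrightarrow> emeasure lebesgue (cell K k) = ennreal (1 / real K)"
  unfolding cell_def by (subst emeasure_lebesgue_Ico) (auto simp: field_simps)

lemma disjoint_family_cell: "0 < K \<Longrightarrow> disjoint_family_on (cell K) I"
  by (auto simp: disjoint_family_on_def mem_cell_iff)

definition cell_average :: "(real \<Rightarrow> real) \<Rightarrow> nat \<Rightarrow> int \<Rightarrow> real" where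
  "cell_average f K k = real K * enn2real (\<integral>\<^sup>+y\<in>cell K k. ennreal \<bar>f y\<bar> \<partial>lebesgue)"

lemma cell_average_nonneg: "0 \<le> cell_average f K k"
  by (simp add: cell_average_def)

text \<open>The \<open>p\<close>-th power of the maximal function of the sequence of cell averages, transplanted to the
  line. The radius and the range \<open>K\<^sup>2\<close>, measured in cells of length \<open>1 / K\<close>, have real length \<open>K\<close>, and
  so exhaust the line as the mesh goes to zero.\<close>

definition cell_maximal :: "real \<Rightarrow> (real \<Rightarrow> real) \<Rightarrow> nat \<Rightarrow> real \<Rightarrow> ennreal" where
  "cell_maximal p f K x =
    (\<Sum>n = - int (K\<^sup>2)..int (K\<^sup>2). ennpow (window_maximal (K\<^sup>2) (cell_average f K) n) p * indicator (cell K n) x)"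

context
  fixes p :: real and f :: "real \<Rightarrow> real"
  assumes p: "1 < p" and f [measurable]: "f \<in> borel_measurable lebesgue"
    and fin: "(\<integral>\<^sup>+x. ennreal (\<bar>f x\<bar> powr p) \<partial>lebesgue) < \<infinity>"
begin

lemma set_nn_integral_cell:
  assumes K: "0 < K"
  shows "(\<integral>\<^sup>+y\<in>cell K k. ennreal \<bar>f y\<bar> \<partial>lebesgue) = ennreal (cell_average f K k / real K)"
proof -
  have "emeasure lebesgue (cell K k) < \<infinity>"
    by (simp only: emeasure_cell[OF K]) simp
  then have "(\<integral>\<^sup>+y\<in>cell K k. ennreal \<bar>f y\<bar> \<partial>lebesgue) < \<infinity>"
    by (rule set_nn_integral_finite_if_powr_finite[OF p f sets_cell _ fin])
  then show ?thesis using K by (simp add: cell_average_def)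
qed

lemma cell_average_powr_le:
  assumes K: "0 < K"
  shows "ennreal (cell_average f K k powr p) * ennreal (1 / real K)
    \<le> (\<integral>\<^sup>+x\<in>cell K k. ennreal (\<bar>f x\<bar> powr p) \<partial>lebesgue)"
  using average_powr_le[OF p f sets_cell emeasure_cell[OF K] _ set_nn_integral_cell[OF K]] K
  by (simp add: cell_average_nonneg)

text \<open>The discrete inequality for the cell averages, multiplied by the mesh \<open>1 / K\<close>. By Jensen's
  inequality, averaging does not increase the norm.\<close>

lemma nn_integral_cell_maximal_le:
  assumes c: "0 \<le> c" and wb: "window_bound p c" and K: "0 < K"
  shows "(\<integral>\<^sup>+x. cell_maximal p f K x \<partial>lebesgue)
    \<le> ennreal (c powr p) * (\<integral>\<^sup>+x. ennreal (\<bar>f x\<bar> powr p) \<partial>lebesgue)"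
proof -
  let ?W = "{- int (K\<^sup>2 + K\<^sup>2)..int (K\<^sup>2 + K\<^sup>2)}"
  have "(\<integral>\<^sup>+x. cell_maximal p f K x \<partial>lebesgue) =
     (\<Sum>n = - int (K\<^sup>2)..int (K\<^sup>2). ennpow (window_maximal (K\<^sup>2) (cell_average f K) n) p) * ennreal (1 / real K)"
    unfolding cell_maximal_def by (subst nn_integral_step) (simp_all only: emeasure_cell[OF K] sum_distrib_right finite_atLeastAtMost_int sets_cell)
  also have "\<dots> \<le> ennreal (c powr p) * (\<Sum>n\<in>?W. ennreal (cell_average f K n powr p)) * ennreal (1 / real K)"
    by (intro mult_right_mono window_boundD[OF wb] cell_average_nonneg) simp
  also have "\<dots> = ennreal (c powr p) * (\<Sum>n\<in>?W. ennreal (cell_average f K n powr p) * ennreal (1 / real K))"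
    by (simp only: sum_distrib_right mult.assoc)
  also have "\<dots> \<le> ennreal (c powr p) * (\<Sum>n\<in>?W. \<integral>\<^sup>+x\<in>cell K n. ennreal (\<bar>f x\<bar> powr p) \<partial>lebesgue)"
    by (intro mult_left_mono sum_mono cell_average_powr_le K) simp
  also have "\<dots> \<le> ennreal (c powr p) * (\<integral>\<^sup>+x. ennreal (\<bar>f x\<bar> powr p) \<partial>lebesgue)"
    by (intro mult_left_mono sum_set_nn_integral_le disjoint_family_cell K) auto
  finally show ?thesis .
qed

text \<open>Enlarge \<open>I\<close> to the union of the cells that meet the hull \<open>{Inf I..Sup I}\<close>. The integral does not
  decrease, the length grows by at most \<open>2 / K\<close>, and the mean over a union of adjacent cells is a
  discrete average of cell averages. The lower bounds on \<open>K\<close> ensure that all cells involved are within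
  the range \<open>K\<^sup>2\<close>.\<close>

lemma interval_average_le_cell_maximal:
  fixes A l :: real
  assumes I: "is_interval I" "bounded I" "I \<in> sets lebesgue" "x \<in> I"
    and l: "emeasure lebesgue I = ennreal l" "0 < l"
    and A: "(\<integral>\<^sup>+y\<in>I. ennreal \<bar>f y\<bar> \<partial>lebesgue) = ennreal A" "0 \<le> A"
    and K: "0 < K" "x - Inf I + 1 \<le> real K" "Sup I - x + 1 \<le> real K" "\<bar>x\<bar> + 1 \<le> real K"
  shows "ennreal ((A / (l + 2 / real K)) powr p) \<le> cell_maximal p f K x"
proof -
  define n u v where "n = \<lfloor>real K * x\<rfloor>" and "u = \<lfloor>real K * Inf I\<rfloor>" and "v = \<lfloor>real K * Sup I\<rfloor>"
  have bdd: "bdd_above I" "bdd_below I" using I(2) by (auto dest: bounded_imp_bdd_above bounded_imp_bdd_below)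
  have Iuv: "Inf I \<le> y" "y \<le> Sup I" if "y \<in> I" for y
    using that bdd by (auto intro: cInf_lower cSup_upper)
  have uv: "u \<le> \<lfloor>real K * y\<rfloor>" "\<lfloor>real K * y\<rfloor> \<le> v" if "y \<in> I" for y
    using Iuv[OF that] by (auto simp: u_def v_def intro!: floor_mono mult_left_mono)
  \<comment> \<open>The cells \<open>u..v\<close> meeting the hull of \<open>I\<close> are the discrete window \<open>n - r..n + s\<close> around the cell of \<open>x\<close>.\<close>
  define r s where "r = nat (n - u)" and "s = nat (v - n)"
  have rs: "n - int r = u" "n + int s = v" using uv[OF I(4)] by (auto simp: r_def s_def n_def)
  have rs_real: "real r = real_of_int n - real_of_int u" "real s = real_of_int v - real_of_int n"
    using rs by linarith+
  have len: "Sup I - Inf I \<le> l"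
    using interval_length_le_emeasure[OF I(1,3) _ I(2)] I(4) l by (auto simp: ennreal_le_iff)
  have KK: "real K * t + 1 \<le> real (K\<^sup>2)" if "t + 1 \<le> real K" for t
  proof -
    have "real K * (t + 1) \<le> real K * real K" using that by (intro mult_left_mono) auto
    then show ?thesis using K(1) by (simp add: power2_eq_square algebra_simps)
  qed
  have fl: "real_of_int n \<le> real K * x" "real K * x < real_of_int n + 1"
    "real_of_int u \<le> real K * Inf I" "real K * Inf I < real_of_int u + 1"
    "real_of_int v \<le> real K * Sup I" "real K * Sup I < real_of_int v + 1"
    unfolding n_def u_def v_def by linarith+
  have "real r \<le> real (K\<^sup>2)" "real s \<le> real (K\<^sup>2)"
    using KK[OF K(2)] KK[OF K(3)] fl unfolding rs_real by (simp_all add: algebra_simps)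
  then have rs_le: "r \<le> K\<^sup>2" "s \<le> K\<^sup>2" by (simp_all only: of_nat_le_iff)
  have "\<bar>real K * x\<bar> + 1 \<le> real (K\<^sup>2)"
    using KK[OF K(4)] by (simp add: abs_mult)
  then have "\<bar>real_of_int n\<bar> \<le> real (K\<^sup>2)" using fl by linarith
  then have n: "n \<in> {- int (K\<^sup>2)..int (K\<^sup>2)}" by (simp only: atLeastAtMost_iff) linarith
  have "ennreal A \<le> (\<integral>\<^sup>+y. (\<Sum>k = u..v. ennreal \<bar>f y\<bar> * indicator (cell K k) y) \<partial>lebesgue)"
    unfolding A(1)[symmetric]
  proof (rule nn_integral_mono)
    fix y :: real
    show "ennreal \<bar>f y\<bar> * indicator I y \<le> (\<Sum>k = u..v. ennreal \<bar>f y\<bar> * indicator (cell K k) y)"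
    proof (cases "y \<in> I")
      case True
      have "(\<Sum>k = u..v. ennreal \<bar>f y\<bar> * indicator (cell K k) y) = ennreal \<bar>f y\<bar>"
        by (rule disjoint_step_eq[where i = "\<lfloor>real K * y\<rfloor>"])
           (use uv[OF True] K in \<open>auto simp: disjoint_family_cell mem_cell_iff\<close>)
      then show ?thesis using True by simp
    qed simp
  qed
  also have "\<dots> = (\<Sum>k = u..v. ennreal (cell_average f K k / real K))"
    by (subst nn_integral_sum) (auto simp: set_nn_integral_cell K)
  also have "\<dots> = ennreal ((\<Sum>k = u..v. cell_average f K k) / real K)"
    by (simp add: sum_ennreal cell_average_nonneg sum_divide_distrib)
  finally have A_le: "A * real K \<le> (\<Sum>k = u..v. cell_average f K k)"
    using K(1) by (simp add: ennreal_le_iff sum_nonneg cell_average_nonneg field_simps)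
  have "A / (l + 2 / real K) = A * real K / (real K * l + 2)"
    using K(1) l(2) by (simp add: field_simps)
  also have "\<dots> \<le> (\<Sum>k = u..v. cell_average f K k) / (real r + real s + 1)"
  proof (rule frac_le[OF _ A_le])
    have "real K * (Sup I - Inf I) \<le> real K * l" using len by (intro mult_left_mono) auto
    then show "real r + real s + 1 \<le> real K * l + 2"
      using fl unfolding rs_real by (simp add: algebra_simps)
  qed (auto intro: sum_nonneg cell_average_nonneg)
  finally have "ennreal (A / (l + 2 / real K)) \<le>
      ennreal ((\<Sum>k = n - int r..n + int s. cell_average f K k) / (real r + real s + 1))"
    unfolding rs by (rule ennreal_leI)
  also have "\<dots> \<le> window_maximal (K\<^sup>2) (cell_average f K) n"
    by (rule window_maximal_ge[OF rs_le])
  finally have "ennpow (ennreal (A / (l + 2 / real K))) p \<le> ennpow (window_maximal (K\<^sup>2) (cell_average f K) n) p"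
    using p by (intro ennpow_mono) auto
  also have "\<dots> = cell_maximal p f K x"
    unfolding cell_maximal_def
    by (rule disjoint_step_eq[symmetric, where i = n])
       (use n K in \<open>auto simp: disjoint_family_cell mem_cell_iff n_def\<close>)
  finally show ?thesis using A(2) l(2) by (simp add: ennpow_ennreal)
qed

text \<open>For each fixed interval, the error \<open>2 / K\<close> in the length disappears in the limit.\<close>

lemma HL_maximal_le_liminf_cell_maximal:
  "ennpow (HL_maximal f x) p \<le> liminf (\<lambda>K. cell_maximal p f (Suc K) x)"
proof -
  let ?L = "liminf (\<lambda>K. cell_maximal p f (Suc K) x)"
  have "ennpow ((\<integral>\<^sup>+y\<in>I. ennreal \<bar>f y\<bar> \<partial>lebesgue) / emeasure lebesgue I) p \<le> ?L"
    if I: "is_interval I" "bounded I" "0 < emeasure lebesgue I" "x \<in> I" for I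
  proof -
    have meas: "I \<in> sets lebesgue" using I(3) by (metis emeasure_notin_sets less_irrefl)
    have "emeasure lebesgue I < \<infinity>"
      using bounded_set_imp_lmeasurable[OF I(2) meas] by (simp only: infinity_ennreal_def fmeasurable_def mem_Collect_eq)
    then obtain l where l: "emeasure lebesgue I = ennreal l" "0 < l"
      using I(3) by (cases "emeasure lebesgue I") (auto simp: ennreal_less_zero_iff)
    have "(\<integral>\<^sup>+y\<in>I. ennreal \<bar>f y\<bar> \<partial>lebesgue) < \<infinity>"
      by (rule set_nn_integral_finite_if_powr_finite[OF p f meas _ fin]) (simp add: l)
    then obtain A where A: "(\<integral>\<^sup>+y\<in>I. ennreal \<bar>f y\<bar> \<partial>lebesgue) = ennreal A" "0 \<le> A"
      by (cases "\<integral>\<^sup>+y\<in>I. ennreal \<bar>f y\<bar> \<partial>lebesgue") auto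
    have "(\<lambda>K. 2 / real (Suc K)) \<longlonglongrightarrow> 0"
      by (rule LIMSEQ_Suc) (rule lim_const_over_n)
    then have "(\<lambda>K. l + 2 / real (Suc K)) \<longlonglongrightarrow> l + 0"
      by (intro tendsto_intros)
    then have "(\<lambda>K. (A / (l + 2 / real (Suc K))) powr p) \<longlonglongrightarrow> (A / l) powr p"
      using l A p by (intro tendsto_powr' tendsto_divide tendsto_const) auto
    then have "(\<lambda>K. ennreal ((A / (l + 2 / real (Suc K))) powr p)) \<longlonglongrightarrow> ennreal ((A / l) powr p)"
      by (rule tendsto_ennrealI)
    then have "ennreal ((A / l) powr p) = liminf (\<lambda>K. ennreal ((A / (l + 2 / real (Suc K))) powr p))"
      by (intro lim_imp_Liminf[symmetric]) auto
    also have "\<dots> \<le> ?L"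
    proof (rule Liminf_mono)
      define B where "B = nat \<lceil>\<bar>x\<bar> + \<bar>x - Inf I\<bar> + \<bar>Sup I - x\<bar> + 1\<rceil>"
      show "\<forall>\<^sub>F K in sequentially. ennreal ((A / (l + 2 / real (Suc K))) powr p) \<le> cell_maximal p f (Suc K) x"
        using eventually_ge_at_top[of B]
      proof eventually_elim
        case (elim K)
        then have "\<bar>x\<bar> + \<bar>x - Inf I\<bar> + \<bar>Sup I - x\<bar> + 1 \<le> real (Suc K)" unfolding B_def by linarith
        then show ?case
          by (intro interval_average_le_cell_maximal[OF I(1,2) meas I(4) l A]) auto
      qed
    qed
    finally show ?thesis using l A by (simp add: divide_ennreal ennpow_ennreal)
  qed
  then show ?thesis
    using p unfolding HL_maximal_def by (auto simp: ennpow_le_iff intro!: SUP_least)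
qed

text \<open>The pointwise bound by a lower limit of functions with uniformly bounded integrals passes to the
  integral by Fatou's lemma.\<close>

lemma nn_integral_HL_maximal_le:
  assumes c: "0 \<le> c" and wb: "window_bound p c"
  shows "(\<integral>\<^sup>+x. ennpow (HL_maximal f x) p \<partial>lebesgue)
    \<le> ennreal (c powr p) * (\<integral>\<^sup>+x. ennreal (\<bar>f x\<bar> powr p) \<partial>lebesgue)"
proof -
  have [measurable]: "cell_maximal p f K \<in> borel_measurable lebesgue" for K
    unfolding cell_maximal_def by measurable
  have "(\<integral>\<^sup>+x. ennpow (HL_maximal f x) p \<partial>lebesgue)
      \<le> (\<integral>\<^sup>+x. liminf (\<lambda>K. cell_maximal p f (Suc K) x) \<partial>lebesgue)"
    by (intro nn_integral_mono HL_maximal_le_liminf_cell_maximal)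
  also have "\<dots> \<le> liminf (\<lambda>K. \<integral>\<^sup>+x. cell_maximal p f (Suc K) x \<partial>lebesgue)"
    by (rule nn_integral_liminf) measurable
  also have "\<dots> \<le> liminf (\<lambda>K. ennreal (c powr p) * (\<integral>\<^sup>+x. ennreal (\<bar>f x\<bar> powr p) \<partial>lebesgue))"
    by (intro Liminf_mono always_eventually allI nn_integral_cell_maximal_le c wb) simp
  also have "\<dots> = ennreal (c powr p) * (\<integral>\<^sup>+x. ennreal (\<bar>f x\<bar> powr p) \<partial>lebesgue)"
    by (rule Liminf_const) simp
  finally show ?thesis .
qed

end

lemma HL_bound_if_window_bound:
  assumes p: "1 < p" and c: "0 \<le> c" and wb: "window_bound p c"
  shows "strong_type_bound p lebesgue HL_maximal (ennreal c)"
  using p c wb by (subst strong_type_bound_iff_nn_integral) (auto intro!: nn_integral_HL_maximal_le)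

section \<open>Equality of the best constants\<close>

theorem proposition1p11:
  fixes M :: "'a measure" and T :: "'a \<Rightarrow> 'a" and p :: real
  assumes "1 < p"
    and "sigma_finite_measure M"
    and "nontrivial_measure M"
    and "measure_preserving M T"
    and "invertible_on_space M T"
    and "ergodic M T"
    and "\<And>L :: nat. 1 \<le> L \<Longrightarrow>
           \<exists>E\<in>sets M. 0 < emeasure M E \<and> emeasure M E < \<infinity> \<and>
             disjoint_family_on (\<lambda>l. (T ^^ l) -` E \<inter> space M) {1..L}"
  shows "ergodic_best_constant M T p = HL_best_constant p"
  unfolding ergodic_best_constant_def HL_best_constant_def
proof (rule best_constant_cong)
  interpret invertible_measure_preserving M T
    using assms(4,5) by unfold_locales
  fix c :: real assume c: "0 \<le> c"
  have p: "0 < p" using assms(1) by simp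
  show "strong_type_bound p M (ergodic_maximal M T) (ennreal c) \<longleftrightarrow>
    strong_type_bound p lebesgue HL_maximal (ennreal c)"
    using window_bound_if_ergodic_bound[OF p c _ assms(7)] ergodic_bound_if_window_bound[OF p c]
      window_bound_if_HL_bound[OF p c] HL_bound_if_window_bound[OF assms(1) c] by blast
qed

end
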